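(* Let $q$ be a prime power and assume that $n$ and $k$ are two integers with $1\leq k\leq n$. Given a nonzero vector $\mathbf{u}\in \mathbb{F}_q^{2n}$, the number of distinct symplectic self-orthogonal $[2n,k]_q$ codes containing $\mathbf{u}$ is $$\frac{(q^{2n-2k+2}-1)(q^{2n-2k+4}-1)\cdots(q^{2n-2}-1)}{(q^{k-1}-1)\cdots(q-1)}.$$
   Context: A linear $[m,k]_q$ code is a $k$-dimensional subspace of $\mathbb{F}_q^m$. On $\mathbb{F}_q^{2n}$ the symplectic inner product is $\langle \mathbf{x},\mathbf{y}\rangle_{\rm s}=\sum_{i=1}^n(x_iy_{n+i}-x_{n+i}y_i)$. For a code $C\subseteq\mathbb{F}_q^{2n}$, $C^{\perp_{\rm s}}=\{\mathbf{y}\in\mathbb{F}_q^{2n} : \langle\mathbf{x},\mathbf{y}\rangle_{\rm s}=0\text{ for all }\mathbf{x}\in C\}$, and $C$ is symplectic self-orthogonal if $C\subseteq C^{\perp_{\rm s}}$. The displayed quotient is $\prod_{i=1}^{k-1}\frac{q^{2n-2i}-1}{q^i-1}$, with the empty product ($k=1$) equal to $1$. *)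

theory Defs
  imports "HOL-Analysis.Analysis"
begin

text \<open>
  The field of \<open>q\<close> elements is a type \<open>'a :: {field, finite}\<close> with \<open>CARD('a) = q\<close>.
  Linear notions on \<open>'a ^ 'm\<close> come from the interpretation \<open>vec\<close> of the vector space locale
  with scalar multiplication \<open>(*s)\<close>; the unqualified \<open>subspace\<close> and \<open>dim\<close> are restricted to
  real scalars.
\<close>

definition linear_code :: "nat \<Rightarrow> nat \<Rightarrow> ('a::field ^ 'm::finite) set \<Rightarrow> bool" where
  "linear_code m k C \<longleftrightarrow> CARD('m) = m \<and> vec.subspace C \<and> vec.dim C = k"

text \<open>
  Coordinates of vectors of length \<open>2n\<close>, \<open>n = CARD('n)\<close>, are indexed by \<open>'n + 'n\<close>:
  \<open>Inl i\<close> plays the role of position \<open>i\<close> and \<open>Inr i\<close> that of position \<open>n + i\<close>.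
\<close>

definition symp_inner :: "'a::field ^ ('n::finite + 'n) \<Rightarrow> 'a ^ ('n + 'n) \<Rightarrow> 'a" where
  "symp_inner x y = (\<Sum>i\<in>UNIV. x $ Inl i * y $ Inr i - x $ Inr i * y $ Inl i)"

definition symp_dual :: "('a::field ^ ('n::finite + 'n)) set \<Rightarrow> ('a ^ ('n + 'n)) set" where
  "symp_dual C = {y. \<forall>x\<in>C. symp_inner x y = 0}"

definition symp_self_orthogonal :: "('a::field ^ ('n::finite + 'n)) set \<Rightarrow> bool" where
  "symp_self_orthogonal C \<longleftrightarrow> C \<subseteq> symp_dual C"

end

theory Submission
  imports Defs
begin

text \<open>
  Count the tuples \<open>v\<^sub>1, \<dots>, v\<^sub>k\<^sub>-\<^sub>1\<close> that extend \<open>u\<close> to a linearly independent family of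
  pairwise orthogonal vectors in two ways. Once \<open>u, v\<^sub>1, \<dots>, v\<^sub>i\<^sub>-\<^sub>1\<close> are chosen, with span \<open>E\<close>, the
  next vector ranges over the difference of the symplectic dual of \<open>E\<close> and \<open>E\<close>, which has
  \<open>q^(2n-i) - q^i\<close> elements. On the other hand, each self-orthogonal code of dimension \<open>k\<close>
  containing \<open>u\<close> is spanned by the \<open>\<Prod>i=1..k-1. (q^k - q^i)\<close> such tuples lying in it.
\<close>

section \<open>Cardinalities of spans and subspaces over a finite field\<close>

lemma card_span_insert:
  fixes a :: "'a::{field,finite} ^ 'm::finite"
  assumes "a \<notin> vec.span S"
  shows "card (vec.span (insert a S)) = CARD('a) * card (vec.span S)"
proof -
  have "bij_betw (\<lambda>(c, y). c *s a + y) (UNIV \<times> vec.span S) (vec.span (insert a S))"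
    unfolding bij_betw_def
  proof
    show "inj_on (\<lambda>(c, y). c *s a + y) (UNIV \<times> vec.span S)"
    proof (rule inj_onI, clarify)
      fix c y d z assume y: "y \<in> vec.span S" and z: "z \<in> vec.span S"
        and eq: "c *s a + y = d *s a + z"
      then have "(c - d) *s a = z - y"
        by (simp add: vec.scale_left_diff_distrib algebra_simps)
      then have "(c - d) *s a \<in> vec.span S"
        using y z by (simp add: vec.span_diff)
      \<comment> \<open>If \<open>c\<close> and \<open>d\<close> differed, dividing by
        \<open>c - d\<close> would put \<open>a\<close> into the span.\<close>
      then have "inverse (c - d) *s ((c - d) *s a) \<in> vec.span S"
        by (rule vec.span_scale)
      then have "c = d"
        using assms by (cases "c = d") (simp_all only: vec.scale_scale left_inverse
            right_minus_eq vec.scale_one not_False_eq_True)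
      then show "c = d \<and> y = z" using eq by simp
    qed
    show "(\<lambda>(c, y). c *s a + y) ` (UNIV \<times> vec.span S) = vec.span (insert a S)"
    proof (intro equalityI subsetI)
      fix x assume "x \<in> vec.span (insert a S)"
      then obtain c where "x - c *s a \<in> vec.span S"
        by (auto simp: vec.span_breakdown_eq)
      then have "(c, x - c *s a) \<in> UNIV \<times> vec.span S" by simp
      then show "x \<in> (\<lambda>(c, y). c *s a + y) ` (UNIV \<times> vec.span S)"
        by (rule rev_image_eqI) simp
    qed (auto intro!: vec.span_add vec.span_scale intro: vec.span_base
          vec.span_mono[THEN subsetD, OF subset_insertI])
  qed
  then show ?thesis
    by (metis bij_betw_same_card card_cartesian_product)
qed

lemma card_span:
  fixes S :: "('a::{field,finite} ^ 'm::finite) set"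
  shows "card (vec.span S) = CARD('a) ^ vec.dim S"
proof (induction S rule: finite_induct[OF finite])
  case 1
  show ?case by simp
next
  case (2 a S)
  then show ?case
    by (cases "a \<in> vec.span S")
      (simp_all add: vec.span_redundant card_span_insert vec.dim_insert)
qed

lemma card_subspace:
  fixes S :: "('a::{field,finite} ^ 'm::finite) set"
  assumes "vec.subspace S"
  shows "card S = CARD('a) ^ vec.dim S"
  using card_span[of S] assms by (simp add: vec.span_eq_iff[THEN iffD2])

section \<open>The symplectic form and duals of sets\<close>

lemma symp_inner_add_right: "symp_inner x (y + z) = symp_inner x y + symp_inner x z"
  by (simp add: symp_inner_def algebra_simps sum.distrib flip: sum.distrib)

lemma symp_inner_scale_right: "symp_inner x (c *s y) = c * symp_inner x y"
  by (simp add: symp_inner_def algebra_simps sum_distrib_left)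

lemma symp_inner_minus_commute: "symp_inner x y = - symp_inner y x"
  by (simp add: symp_inner_def algebra_simps flip: sum_negf)

lemma symp_inner_zero_right [simp]: "symp_inner x 0 = 0"
  by (simp add: symp_inner_def)

lemma symp_inner_self [simp]: "symp_inner x x = 0"
  by (simp add: symp_inner_def algebra_simps)

lemma symp_inner_diff_right: "symp_inner x (y - z) = symp_inner x y - symp_inner x z"
  using symp_inner_add_right[of x "y - z" z] by simp

lemma symp_inner_eq_0_commute: "symp_inner x y = 0 \<longleftrightarrow> symp_inner y x = 0"
  by (metis symp_inner_minus_commute neg_equal_0_iff_equal)

lemma subspace_symp_dual: "vec.subspace (symp_dual S)"
  by (auto simp: vec.subspace_def symp_dual_def symp_inner_add_right symp_inner_scale_right)

lemma symp_dual_antimono: "S \<subseteq> T \<Longrightarrow> symp_dual T \<subseteq> symp_dual S"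
  by (auto simp: symp_dual_def)

lemma subset_symp_dual_commute: "S \<subseteq> symp_dual T \<longleftrightarrow> T \<subseteq> symp_dual S"
  unfolding symp_dual_def using symp_inner_eq_0_commute by blast

lemma symp_dual_span: "symp_dual (vec.span S) = symp_dual S"
proof
  show "symp_dual S \<subseteq> symp_dual (vec.span S)"
    \<comment> \<open>By symmetry the goal says that the span of \<open>S\<close> lies in the double
      dual; this is a subspace, so it is enough that \<open>S\<close> lies in it.\<close>
    by (metis subset_symp_dual_commute order_refl subspace_symp_dual vec.span_minimal)
qed (intro symp_dual_antimono vec.span_superset)

lemma symp_self_orthogonal_span:
  "symp_self_orthogonal (vec.span S) \<longleftrightarrow> symp_self_orthogonal S"
  unfolding symp_self_orthogonal_def symp_dual_span
  by (meson subspace_symp_dual vec.span_minimal vec.span_superset subset_trans)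

text \<open>The form is alternating, so \<open>v\<close> is orthogonal to itself and only its
  products with \<open>S\<close> matter.\<close>

lemma symp_self_orthogonal_insert:
  "symp_self_orthogonal (insert v S) \<longleftrightarrow> symp_self_orthogonal S \<and> v \<in> symp_dual S"
  by (auto simp: symp_self_orthogonal_def symp_dual_def symp_inner_eq_0_commute)

text \<open>Nondegeneracy: pairing with the unit vectors reads off every coordinate of
  \<open>y\<close> up to sign.\<close>

lemma symp_dual_UNIV: "symp_dual (UNIV :: ('a::field ^ ('n::finite + 'n)) set) = {0}"
proof -
  have "y = 0" if "\<And>x. symp_inner x y = 0" for y :: "'a ^ ('n + 'n)"
  proof (rule vec_eq_iff[THEN iffD2], rule)
    fix j :: "'n + 'n"
    have "symp_inner (axis (Inl i) 1) y = y $ Inr i"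
      "symp_inner (axis (Inr i) 1) y = - y $ Inl i" for i
      by (simp_all add: symp_inner_def axis_def if_distrib if_distribR cong: if_cong
          flip: sum_negf)
    with that show "y $ j = 0 $ j"
      by (cases j) (metis neg_equal_0_iff_equal zero_index)+
  qed
  then show ?thesis by (auto simp: symp_dual_def)
qed

section \<open>Cardinality of a symplectic dual\<close>

text \<open>The smaller dual is the kernel of pairing with \<open>a\<close> on
  \<open>symp_dual S\<close>. The fibres \<open>F c\<close> of this map, one for each scalar, are no
  larger than the kernel.\<close>

lemma card_symp_dual_le_insert:
  fixes S :: "('a::{field,finite} ^ ('n::finite + 'n)) set"
  shows "card (symp_dual S) \<le> CARD('a) * card (symp_dual (insert a S))"
proof -
  define F where "F c = {y \<in> symp_dual S. symp_inner a y = c}" for c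
  have le: "card (F c) \<le> card (symp_dual (insert a S))" for c
  proof (cases "F c = {}")
    case False
    then obtain z where z: "z \<in> F c" by auto
    show ?thesis
      \<comment> \<open>Subtracting a fixed element of the fibre maps it injectively into the
        kernel.\<close>
      by (rule card_inj_on_le[of "\<lambda>y. y - z"])
        (use z in \<open>auto simp: F_def symp_dual_def symp_inner_diff_right inj_on_def\<close>)
  qed simp
  have "card (symp_dual S) = card (\<Union>c. F c)"
    by (rule arg_cong[of _ _ card]) (auto simp: F_def)
  also have "\<dots> \<le> (\<Sum>c\<in>UNIV. card (F c))"
    by (rule card_UN_le) simp
  also have "\<dots> \<le> CARD('a) * card (symp_dual (insert a S))"
    using sum_bounded_above[of UNIV, OF le] by simp
  finally show ?thesis .
qed

lemma card_symp_dual_le_Un: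
  fixes S T :: "('a::{field,finite} ^ ('n::finite + 'n)) set"
  shows "card (symp_dual S) \<le> CARD('a) ^ card T * card (symp_dual (T \<union> S))"
proof (induction T rule: finite_induct[OF finite])
  case (2 a T)
  note 2(3)
  also have "CARD('a) ^ card T * card (symp_dual (T \<union> S))
      \<le> CARD('a) ^ card T * (CARD('a) * card (symp_dual (insert a (T \<union> S))))"
    by (intro mult_left_mono card_symp_dual_le_insert) simp
  finally show ?case using 2 by (simp add: mult_ac)
qed simp

text \<open>
  Both inequalities come from the previous lemma: adjoining to a basis of the span of \<open>S\<close> the rest
  of a basis of the whole space bounds the dual from above, building the basis of the span from
  the empty set bounds it from below.
\<close>

lemma card_symp_dual:
  fixes S :: "('a::{field,finite} ^ ('n::finite + 'n)) set"
  shows "card (symp_dual S) = CARD('a) ^ (2 * CARD('n) - vec.dim S)"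
proof -
  let ?q = "CARD('a)" and ?N = "2 * CARD('n)"
  obtain A where A: "A \<subseteq> S" "vec.independent A" "S \<subseteq> vec.span A" "card A = vec.dim S"
    using vec.basis_exists by blast
  have dualA: "symp_dual A = symp_dual S"
    using A by (metis subset_antisym symp_dual_antimono symp_dual_span)
  obtain B where B: "A \<subseteq> B" "vec.independent B" "UNIV \<subseteq> vec.span B"
    using vec.maximal_independent_subset_extend[of A UNIV] A(2) by auto
  have cardB: "card B = ?N"
  proof -
    have "vec.dim (UNIV :: ('a ^ ('n + 'n)) set) = card B"
      using B by (intro vec.dim_eq_card) (auto simp: top_unique)
    then show ?thesis by (simp only: vec_dim_card) (simp flip: UNIV_Plus_UNIV add: card_Plus)
  qed
  have dimle: "vec.dim S \<le> ?N"
    using A(4) B(1) cardB by (metis card_mono finite)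
  have dualB: "symp_dual B = {0}"
    using B(3) by (metis symp_dual_UNIV symp_dual_span top.extremum_uniqueI)
  have "card (symp_dual A) \<le> ?q ^ card (B - A) * card (symp_dual (B - A \<union> A))"
    by (rule card_symp_dual_le_Un)
  moreover have "B - A \<union> A = B" using B(1) by auto
  ultimately have le: "card (symp_dual S) \<le> ?q ^ (?N - vec.dim S)"
    using B(1) by (simp add: dualA dualB card_Diff_subset cardB A(4))
  have "symp_dual {} = (UNIV :: ('a ^ ('n + 'n)) set)"
    by (simp add: symp_dual_def)
  then have "?q ^ ?N \<le> ?q ^ vec.dim S * card (symp_dual S)"
    using card_symp_dual_le_Un[of "{}" A] by (simp add: dualA A(4) card_Plus CARD_vec mult_2)
  then have "?q ^ vec.dim S * ?q ^ (?N - vec.dim S) \<le> ?q ^ vec.dim S * card (symp_dual S)"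
    using dimle by (simp flip: power_add)
  then have "?q ^ (?N - vec.dim S) \<le> card (symp_dual S)"
    by simp
  with le show ?thesis by simp
qed

section \<open>Counting the extending tuples\<close>

text \<open>
  The constraint \<open>W\<close> on the next vector depends on the vectors already chosen: it is
  \<^const>\<open>symp_dual\<close> for tuples in the whole space, and constantly \<open>C\<close> for tuples in a code \<open>C\<close>.
\<close>

primrec indep_lists ::
    "(('a::field ^ 'm::finite) set \<Rightarrow> ('a ^ 'm) set) \<Rightarrow> 'a ^ 'm \<Rightarrow> nat \<Rightarrow> ('a ^ 'm) list set" where
  "indep_lists W u 0 = {[]}"
| "indep_lists W u (Suc m) = (\<lambda>(vs, v). v # vs) `
    (SIGMA vs:indep_lists W u m. W (insert u (set vs)) - vec.span (insert u (set vs)))"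

lemma dim_indep_lists:
  assumes "vs \<in> indep_lists W u m" "u \<noteq> 0"
  shows "vec.dim (insert u (set vs)) = Suc m"
  using assms(1)
proof (induction m arbitrary: vs)
  case 0
  then show ?case using assms(2) by (simp add: vec.dim_insert)
next
  case (Suc m)
  then obtain ws v where vs: "vs = v # ws" "ws \<in> indep_lists W u m"
    and v: "v \<notin> vec.span (insert u (set ws))"
    by auto
  have "insert u (set vs) = insert v (insert u (set ws))"
    using vs(1) by auto
  then show ?case
    using v Suc.IH[OF vs(2)] by (simp only: vec.dim_insert if_False Suc_eq_plus1)
qed

text \<open>The number of choices at each step depends only on the length reached. Finiteness is
  carried through the induction because the type of lists is infinite.\<close>

lemma card_indep_lists:
  fixes u :: "'a::{field,finite} ^ 'm::finite"
  assumes "\<And>i vs. i < m \<Longrightarrow> vs \<in> indep_lists W u i \<Longrightarrow>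
    card (W (insert u (set vs)) - vec.span (insert u (set vs))) = c i"
  shows "finite (indep_lists W u m) \<and> card (indep_lists W u m) = (\<Prod>i<m. c i)"
  using assms
proof (induction m)
  case (Suc m)
  then have IH: "finite (indep_lists W u m)" "card (indep_lists W u m) = (\<Prod>i<m. c i)"
    by auto
  have "inj_on (\<lambda>(vs, v). v # vs) X" for X :: "(('a ^ 'm) list \<times> ('a ^ 'm)) set"
    by (auto simp: inj_on_def)
  then show ?case
    using IH Suc.prems[of m] by (simp add: card_image card_SigmaI mult.commute)
qed simp

lemma indep_lists_symp_dual_self_orthogonal:
  assumes "vs \<in> indep_lists symp_dual u m"
  shows "symp_self_orthogonal (insert u (set vs))"
  using assms
proof (induction m arbitrary: vs)
  case 0
  then show ?case by (simp add: symp_self_orthogonal_def symp_dual_def)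
next
  case (Suc m)
  then show ?case
    by (auto simp: insert_commute[of u] symp_self_orthogonal_insert[of _ "insert u _"])
qed

lemma card_indep_lists_symp_dual:
  fixes u :: "'a::{field,finite} ^ ('n::finite + 'n)"
  assumes "u \<noteq> 0"
  shows "finite (indep_lists symp_dual u m) \<and> card (indep_lists symp_dual u m)
    = (\<Prod>i<m. CARD('a) ^ (2 * CARD('n) - Suc i) - CARD('a) ^ Suc i)"
proof (rule card_indep_lists)
  fix i and vs :: "('a ^ ('n + 'n)) list"
  assume vs: "vs \<in> indep_lists symp_dual u i"
  let ?S = "insert u (set vs)"
  \<comment> \<open>This inclusion turns the size of the set difference into a difference of
    sizes.\<close>
  have "vec.span ?S \<subseteq> symp_dual ?S"
    using indep_lists_symp_dual_self_orthogonal[OF vs]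
    by (metis symp_self_orthogonal_span symp_self_orthogonal_def symp_dual_span)
  then show "card (symp_dual ?S - vec.span ?S)
      = CARD('a) ^ (2 * CARD('n) - Suc i) - CARD('a) ^ Suc i"
    using dim_indep_lists[OF vs assms]
    by (simp only: card_Diff_subset[OF finite] card_symp_dual card_span)
qed

lemma set_indep_lists_subset:
  "vs \<in> indep_lists (\<lambda>_. C) u m \<Longrightarrow> set vs \<subseteq> C"
  by (induction m arbitrary: vs) (auto simp: subset_iff)

lemma card_indep_lists_subspace:
  fixes u :: "'a::{field,finite} ^ 'm::finite"
  assumes "u \<noteq> 0" "vec.subspace C" "u \<in> C"
  shows "card (indep_lists (\<lambda>_. C) u m)
    = (\<Prod>i<m. CARD('a) ^ vec.dim C - CARD('a) ^ Suc i)"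
proof (rule card_indep_lists[THEN conjunct2])
  fix i and vs :: "('a ^ 'm) list"
  assume vs: "vs \<in> indep_lists (\<lambda>_. C) u i"
  have "vec.span (insert u (set vs)) \<subseteq> C"
    using set_indep_lists_subset[OF vs] assms by (intro vec.span_minimal) auto
  then show "card (C - vec.span (insert u (set vs)))
      = CARD('a) ^ vec.dim C - CARD('a) ^ Suc i"
    using dim_indep_lists[OF vs assms(1)] card_subspace[OF assms(2)]
    by (simp only: card_Diff_subset[OF finite] card_span)
qed

text \<open>Inside a self-orthogonal \<open>C\<close> containing \<open>u\<close> the orthogonality
  constraint holds automatically, leaving only linear independence.\<close>

lemma indep_lists_subspace_iff:
  assumes "vec.subspace C" "symp_self_orthogonal C" "u \<in> C"
  shows "vs \<in> indep_lists (\<lambda>_. C) u m \<longleftrightarrow> vs \<in> indep_lists symp_dual u m \<and> set vs \<subseteq> C"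
proof (induction m arbitrary: vs)
  case (Suc m)
  have "v \<in> symp_dual (insert u (set ws))" if "v \<in> C" "set ws \<subseteq> C" for v ws
    using that assms(2,3) by (auto simp: symp_self_orthogonal_def symp_dual_def)
  then show ?case using Suc.IH by auto
qed auto

text \<open>A tuple lying in \<open>C\<close> spans, together with \<open>u\<close>, a subspace of
  \<open>C\<close> of the same dimension \<open>Suc m\<close>, hence all of
  \<open>C\<close>.\<close>

lemma indep_lists_fibre:
  assumes "u \<noteq> 0" "vec.subspace C" "symp_self_orthogonal C" "u \<in> C" "vec.dim C = Suc m"
  shows "{vs \<in> indep_lists symp_dual u m. vec.span (insert u (set vs)) = C}
    = indep_lists (\<lambda>_. C) u m"
proof -
  have "vec.span (insert u (set vs)) = C \<longleftrightarrow> set vs \<subseteq> C"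
    if vs: "vs \<in> indep_lists symp_dual u m" for vs
  proof
    assume "set vs \<subseteq> C"
    then have "vec.span (insert u (set vs)) \<subseteq> C"
      using assms by (intro vec.span_minimal) auto
    then show "vec.span (insert u (set vs)) = C"
      using dim_indep_lists[OF vs assms(1)] assms
      by (intro vec.subspace_dim_equal) auto
  qed (use vec.span_superset in blast)
  then show ?thesis
    using indep_lists_subspace_iff[OF assms(2,3,4)] by blast
qed

section \<open>The double count and the evaluation of the quotient\<close>

theorem lemma4p11:
  fixes u :: "'a::{field,finite} ^ ('n::finite + 'n)"
    and q n k :: nat
  assumes "CARD('a) = q" and "CARD('n) = n"
    and "1 \<le> k" and "k \<le> n"
    and "u \<noteq> 0"
  shows "real (card {C :: ('a ^ ('n + 'n)) set.
            linear_code (2 * n) k C \<and> symp_self_orthogonal C \<and> u \<in> C})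
       = (\<Prod>i=1..k-1. (real q ^ (2 * n - 2 * i) - 1) / (real q ^ i - 1))"
proof -
  obtain m where k: "k = Suc m" using assms(3) by (cases k) auto
  define Cs where "Cs = {C :: ('a ^ ('n + 'n)) set.
    linear_code (2 * n) k C \<and> symp_self_orthogonal C \<and> u \<in> C}"
  define L where "L = indep_lists symp_dual u m"
  let ?sp = "\<lambda>vs. vec.span (insert u (set vs))"
  have Cs_iff: "C \<in> Cs \<longleftrightarrow> vec.subspace C \<and> vec.dim C = Suc m \<and> symp_self_orthogonal C \<and> u \<in> C"
    for C
    using assms(2) by (auto simp: Cs_def linear_code_def k card_Plus)
  have q: "2 \<le> q"
    using card_mono[of UNIV "{0, 1 :: 'a}"] assms(1) by simp
  have sp: "?sp vs \<in> Cs" if "vs \<in> L" for vs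
    using that dim_indep_lists[OF _ assms(5)] indep_lists_symp_dual_self_orthogonal
    by (auto simp: Cs_iff L_def symp_self_orthogonal_span vec.span_base)
  have fib: "card {vs \<in> L. ?sp vs = C} = (\<Prod>i<m. q ^ k - q ^ Suc i)" if "C \<in> Cs" for C
    using that indep_lists_fibre[OF assms(5), of C m] card_indep_lists_subspace[OF assms(5), of C m]
    by (simp add: Cs_iff L_def k assms(1))
  have L: "finite L" "card L = (\<Prod>i<m. q ^ (2 * n - Suc i) - q ^ Suc i)"
    using card_indep_lists_symp_dual[OF assms(5), of m] by (simp_all add: L_def assms(1,2))
  \<comment> \<open>The tuples are grouped by the code that they span with \<open>u\<close>; by
    \<open>sp\<close> each one falls into a class indexed by \<open>Cs\<close>.\<close>
  have "card L = (\<Sum>C\<in>Cs. card {vs \<in> L. ?sp vs = C})"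
    unfolding card_eq_sum by (rule sum.group[symmetric]) (use L(1) sp in auto)
  also have "\<dots> = card Cs * (\<Prod>i<m. q ^ k - q ^ Suc i)"
    using fib by simp
  finally have count: "real (card Cs) * real (\<Prod>i<m. q ^ k - q ^ Suc i) =
      real (\<Prod>i<m. q ^ (2 * n - Suc i) - q ^ Suc i)"
    unfolding L by (metis of_nat_mult)
  \<comment> \<open>Both products have factors of this shape. The hypothesis
    \<open>a \<le> b\<close> keeps the natural subtractions from being truncated.\<close>
  have factor: "real (q ^ b - q ^ a) = real q ^ a * (real q ^ (b - a) - 1)" if "a \<le> b" for a b
    using that q by (simp add: of_nat_diff power_increasing algebra_simps flip: power_add)
  have pos: "real q ^ j - 1 > 0" if "j > 0" for j
    using q that by (simp add: one_less_power)
  have "real (\<Prod>i<m. q ^ k - q ^ Suc i)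
      = (\<Prod>i<m. real q ^ Suc i) * (\<Prod>i<m. real q ^ (m - i) - 1)"
    by (simp only: of_nat_prod flip: prod.distrib)
      (rule prod.cong, simp_all add: factor k del: power_Suc)
  \<comment> \<open>The factors are taken in reverse order, so that the exponents run upwards from
    1.\<close>
  also have "(\<Prod>i<m. real q ^ (m - i) - 1) = (\<Prod>i<m. real q ^ Suc i - 1)"
    by (rule prod.reindex_bij_witness[of _ "\<lambda>i. m - Suc i" "\<lambda>i. m - Suc i"])
      (auto simp: Suc_diff_Suc simp del: power_Suc)
  finally have 1: "real (\<Prod>i<m. q ^ k - q ^ Suc i)
      = (\<Prod>i<m. real q ^ Suc i) * (\<Prod>i<m. real q ^ Suc i - 1)" .
  have 2: "real (\<Prod>i<m. q ^ (2 * n - Suc i) - q ^ Suc i)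
      = (\<Prod>i<m. real q ^ Suc i) * (\<Prod>i<m. real q ^ (2 * n - 2 * Suc i) - 1)"
    unfolding of_nat_prod prod.distrib[symmetric]
  proof (rule prod.cong)
    fix i assume "i \<in> {..<m}"
    \<comment> \<open>This is where \<open>k \<le> n\<close> enters: it gives
      \<open>Suc i \<le> m < n\<close>.\<close>
    then have "Suc i \<le> 2 * n - Suc i" using assms(4) k by simp
    then show "real (q ^ (2 * n - Suc i) - q ^ Suc i)
        = real q ^ Suc i * (real q ^ (2 * n - 2 * Suc i) - 1)"
      by (simp add: factor mult_2 del: power_Suc)
  qed simp
  have "real q ^ Suc i - 1 \<noteq> 0" for i
    using pos[of "Suc i"] by linarith
  then have ne: "(\<Prod>i<m. real q ^ Suc i) \<noteq> 0" "(\<Prod>i<m. real q ^ Suc i - 1) \<noteq> 0"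
    using q by (simp_all del: power_Suc)
  \<comment> \<open>The powers of \<open>q\<close> pulled out of \<open>1\<close> and
    \<open>2\<close> form the same nonzero product and cancel.\<close>
  have "real (card Cs) = (\<Prod>i<m. real q ^ (2 * n - 2 * Suc i) - 1) / (\<Prod>i<m. real q ^ Suc i - 1)"
    using count ne unfolding 1 2 by (simp add: field_simps del: power_Suc)
  also have "\<dots> = (\<Prod>i=1..k-1. (real q ^ (2 * n - 2 * i) - 1) / (real q ^ i - 1))"
    by (simp add: k prod.atLeast1_atMost_eq prod_dividef del: power_Suc)
  finally show ?thesis unfolding Cs_def .
qed

end
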